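(* Let $n\ge2$ be a positive integer, $\bar x\in\mathbb{E}$, and $f\in\mathcal{F}_n(\bar x)$. Then $\bar x$ is an isolated local minimizer of order $n$ of $f$ if and only if \[ 0\in\partial^{(1)}_- f(\bar x),\qquad 0\in\partial^{(i)}_- f(\bar x;\underbrace{0,0,\dots,0}_{(i-1)\text{ times}}),\quad i=2,3,\dots,n-1. \]
   Context: $\mathbb{E}$ is a real finite-dimensional Euclidean space. $L^1(\mathbb{E})=L(\mathbb{E},\mathbb{R})$ is the space of continuous linear functionals, and $L^n(\mathbb{E})=L(\mathbb{E},L^{n-1}(\mathbb{E}))$ for $n>1$. A function $f:\mathbb{E}\to\mathbb{R}\cup\{+\infty\}$ is called a proper extended real function (it never takes the value $-\infty$), and $\mathrm{dom}\,f=\{x\in\mathbb{E}\mid f(x)<+\infty\}$. For $x\in\mathrm{dom}\,f$ and $u\in\mathbb{E}$, the lower Hadamard directional derivative is \[ f^{(1)}_-(x;u)=\liminf_{t\downarrow 0,\,u'\to u} t^{-1}[f(x+tu')-f(x)] \] (here $t\to0$ through positive values and $\|u'-u\|\to 0$), and the lower Hadamard subdifferential is $\partial^{(1)}_- f(x)=\{x^*\in L^1(\mathbb{E})\mid x^*(u)\le f^{(1)}_-(x;u)\ \forall u\in\mathbb{E}\}$. Recursively, for an integer $n\ge2$, given $x_1^*\in\partial^{(1)}_- f(x)$ and $x_i^*\in\partial^{(i)}_- f(x;x_1^*,\dots,x_{i-1}^* )$ for $i=2,\dots,n-1$, the lower derivative of Hadamard type of order $n$ is the element of $[-\infty,+\infty]$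 \[ f^{(n)}_-(x;x_1^*,\dots,x_{n-1}^*;u)=\liminf_{t\downarrow0,\,u'\to u} n!\,t^{-n}\Big[f(x+tu')-f(x)-\sum_{i=1}^{n-1}\frac{t^i}{i!}\,x_i^*\underbrace{(u')\dots(u')}_{i\text{ times}}\Big], \] and the lower subdifferential of Hadamard type of order $n$ is \[ \partial^{(n)}_- f(x;x_1^*,\dots,x_{n-1}^* )=\{x^*\in L^n(\mathbb{E})\mid x^*\underbrace{(u)\dots(u)}_{n\text{ times}}\le f^{(n)}_-(x;x_1^*,\dots,x_{n-1}^*;u)\ \forall u\in\mathbb{E}\}. \] The classes $\mathcal{F}_n(x)$. A proper extended real function $f$ belongs to $\mathcal{F}_2(x)$ iff $x\in\mathrm{dom}\,f$ and for every $u\in\mathbb{E}$ with $\|u\|=1$ and $f^{(1)}_-(x;u)=0$ there exist positive numbers $\varepsilon,\delta,\alpha$ such that $f(x+tu')\ge f(x)+\alpha t^2$ for all $t\in\mathbb{R}$, $u'\in\mathbb{E}$ with $0\le t<\delta$, $\|u'-u\|<\varepsilon$. For an integer $n\ge3$, $f$ belongs to $\mathcal{F}_n(x)$ iff $x\in\mathrm{dom}\,f$ and for every $u\in\mathbb{E}$ with $\|u\|=1$ such that \[ 0\in\partial^{(1)}_- f(x),\quad 0\in\partial^{(i)}_- f(x;\underbrace{0,\dots,0}_{(i-1)\text{ times}}),\ i=2,\dots,n-2, \] \[ f^{(1)}_-(x;u)=0,\quad f^{(i)}_-(x;\underbrace{0,\dots,0}_{(i-1)\text{ times}};u)=0,\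 i=2,\dots,n-1, \] there exist positive numbers $\varepsilon,\delta,\alpha$ such that $f(x+tu')\ge f(x)+\alpha t^n$ for all $t\in\mathbb{R}$, $u'\in\mathbb{E}$ with $0\le t<\delta$, $\|u'-u\|<\varepsilon$. A point $\bar x\in\mathrm{dom}\,f$ is an isolated local minimizer of order $n$ of $f$ iff there exist a neighbourhood $N$ of $\bar x$ and a constant $C>0$ with $f(x)\ge f(\bar x)+C\|x-\bar x\|^n$ for all $x\in N$. *)

theory Defs
  imports "HOL-Analysis.Analysis"
begin

text \<open>
  The iterated spaces \<open>L\<^sup>n(E) = L(E, L\<^sup>n\<^sup>-\<^sup>1(E))\<close>, with \<open>L\<^sup>0(E)\<close> the reals. HOL has no type
  depending on \<open>n\<close>, so \<open>\<phi> \<in> L\<^sup>n(E)\<close> is encoded in uncurried form: \<open>\<phi> [u\<^sub>1, \<dots>, u\<^sub>n]\<close> stands for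
  \<open>\<phi>(u\<^sub>1)\<dots>(u\<^sub>n)\<close>, the element \<open>\<phi>(u)\<close> of \<open>L\<^sup>n\<^sup>-\<^sup>1(E)\<close> is \<open>\<lambda>us. \<phi> (u # us)\<close>, and \<open>\<phi>\<close> is \<open>0\<close> on
  lists of any other length, which makes the encoding unique. The last conjunct is continuity
  of \<open>u \<mapsto> \<phi>(u)\<close> for the operator norm on \<open>L\<^sup>n\<^sup>-\<^sup>1(E)\<close>, i.e. \<open>\<parallel>\<phi>(u)\<parallel> \<le> K \<parallel>u\<parallel>\<close> with the iterated
  operator norm of \<open>\<phi>(u)\<close> written out.
\<close>

fun Lspace :: "nat \<Rightarrow> ('a::real_normed_vector list \<Rightarrow> real) set" where
  "Lspace 0 = {\<phi>. \<forall>us. us \<noteq> [] \<longrightarrow> \<phi> us = 0}"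
| "Lspace (Suc n) = {\<phi>. \<phi> [] = 0 \<and>
     (\<forall>u. (\<lambda>us. \<phi> (u # us)) \<in> Lspace n) \<and>
     (\<forall>us. linear (\<lambda>u. \<phi> (u # us))) \<and>
     (\<exists>K. \<forall>u us. length us = n \<longrightarrow> \<bar>\<phi> (u # us)\<bar> \<le> K * norm u * prod_list (map norm us))}"

definition Lzero :: "'a list \<Rightarrow> real" where
  "Lzero = (\<lambda>_. 0)"

definition proper_ext :: "('a \<Rightarrow> ereal) \<Rightarrow> bool" where
  "proper_ext f \<longleftrightarrow> (\<forall>x. f x \<noteq> -\<infinity>)"

definition edom :: "('a \<Rightarrow> ereal) \<Rightarrow> 'a set" where
  "edom f = {x. f x < \<infinity>}"

text \<open>
  The order is \<open>n = length xs + 1\<close>, where \<open>xs = [x\<^sub>1, \<dots>, x\<^sub>n\<^sub>-\<^sub>1]\<close> lists the given functionals (so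
  \<open>xs ! (i - 1)\<close> is \<open>x\<^sub>i\<close>); \<open>xs = []\<close> gives the first order notions. The definitions are total, but
  are meaningful only for proper \<open>f\<close>, \<open>x\<close> in the domain of \<open>f\<close>, and each \<open>x\<^sub>i\<close> in the subdifferential
  of order \<open>i\<close> given by its predecessors. The filter \<open>nhds u\<close>
  (not \<open>at u\<close>) lets \<open>u' = u\<close> take part in the limit inferior.
\<close>

definition lower_deriv ::
  "('a::euclidean_space \<Rightarrow> ereal) \<Rightarrow> 'a \<Rightarrow> ('a list \<Rightarrow> real) list \<Rightarrow> 'a \<Rightarrow> ereal" where
  "lower_deriv f x xs u =
     (let n = Suc (length xs) in
      Liminf (at_right (0::real) \<times>\<^sub>F nhds u)
        (\<lambda>(t, u'). ereal (fact n / t ^ n) *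
           (f (x + t *\<^sub>R u') - f x -
            ereal (\<Sum>i = 1..n - 1. t ^ i / fact i * (xs ! (i - 1)) (replicate i u')))))"

definition lower_subdiff ::
  "('a::euclidean_space \<Rightarrow> ereal) \<Rightarrow> 'a \<Rightarrow> ('a list \<Rightarrow> real) list \<Rightarrow> ('a list \<Rightarrow> real) set" where
  "lower_subdiff f x xs =
     (let n = Suc (length xs) in
      {\<phi> \<in> Lspace n. \<forall>u. ereal (\<phi> (replicate n u)) \<le> lower_deriv f x xs u})"

lemma lower_deriv_Nil:
  "lower_deriv f x [] u =
     Liminf (at_right 0 \<times>\<^sub>F nhds u) (\<lambda>(t, u'). ereal (1 / t) * (f (x + t *\<^sub>R u') - f x))"
  by (simp add: lower_deriv_def flip: zero_ereal_def)

lemma Lspace_1_iff: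
  "\<phi> \<in> Lspace (Suc 0) \<longleftrightarrow> bounded_linear (\<lambda>u. \<phi> [u]) \<and> (\<forall>us. length us \<noteq> 1 \<longrightarrow> \<phi> us = 0)"
  (is "?L \<longleftrightarrow> ?R")
proof
  assume ?L
  then have a: "\<phi> [] = 0" "\<And>u us. us \<noteq> [] \<Longrightarrow> \<phi> (u # us) = 0" "linear (\<lambda>u. \<phi> [u])"
    and "\<exists>K. \<forall>u. \<bar>\<phi> [u]\<bar> \<le> K * norm u" by auto
  then obtain K where "\<And>u. \<bar>\<phi> [u]\<bar> \<le> norm u * K" by (auto simp: mult.commute)
  with a(3) have "bounded_linear (\<lambda>u. \<phi> [u])"
    by (auto simp: bounded_linear_def bounded_linear_axioms_def)
  moreover have "\<phi> us = 0" if "length us \<noteq> 1" for us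
    using a that by (cases us) auto
  ultimately show ?R by blast
next
  assume R: ?R
  then have z: "\<And>u us. us \<noteq> [] \<Longrightarrow> \<phi> (u # us) = 0" and l: "linear (\<lambda>u. \<phi> [u])"
    by (auto simp: bounded_linear_def)
  have "linear (\<lambda>u. \<phi> (u # us))" for us
    by (cases "us = []") (use l z in \<open>auto simp: linear_iff\<close>)
  moreover obtain K where "\<And>u. \<bar>\<phi> [u]\<bar> \<le> K * norm u"
    using bounded_linear.bounded[of "\<lambda>u. \<phi> [u]"] R by (auto simp: mult.commute)
  ultimately show ?L using R z by auto
qed

text \<open>
  The two cases \<open>n = 2\<close> and \<open>n \<ge> 3\<close> of the definition are merged: first order is \<open>i = 1\<close>, and for
  \<open>n = 2\<close> the range \<open>{1..n - 2}\<close> is empty and \<open>{1..n - 1}\<close> is \<open>{1}\<close>.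
\<close>

definition Fclass :: "nat \<Rightarrow> 'a::euclidean_space \<Rightarrow> ('a \<Rightarrow> ereal) set" where
  "Fclass n x = {f. proper_ext f \<and> x \<in> edom f \<and>
     (\<forall>u. norm u = 1 \<longrightarrow>
        (\<forall>i\<in>{1..n - 2}. Lzero \<in> lower_subdiff f x (replicate (i - 1) Lzero)) \<longrightarrow>
        (\<forall>i\<in>{1..n - 1}. lower_deriv f x (replicate (i - 1) Lzero) u = 0) \<longrightarrow>
        (\<exists>\<epsilon>>0. \<exists>\<delta>>0. \<exists>\<alpha>>0. \<forall>(t::real) u'. 0 \<le> t \<and> t < \<delta> \<and> norm (u' - u) < \<epsilon> \<longrightarrow>
           f (x + t *\<^sub>R u') \<ge> f x + ereal (\<alpha> * t ^ n)))}"

definition isolated_local_minimizer ::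
  "nat \<Rightarrow> ('a::euclidean_space \<Rightarrow> ereal) \<Rightarrow> 'a \<Rightarrow> bool" where
  "isolated_local_minimizer n f x \<longleftrightarrow> x \<in> edom f \<and>
     (\<exists>N. x \<in> interior N \<and>
        (\<exists>C>0. \<forall>y\<in>N. f y \<ge> f x + ereal (C * norm (y - x) ^ n)))"

end

theory Submission
  imports Defs
begin

text \<open>
  With all prescribed functionals equal to zero, the derivative of order \<open>i\<close> is the lower limit of
  \<open>i! t\<^sup>-\<^sup>i (f (x + t u') - f x)\<close>, and zero is a subgradient exactly when this is nonnegative in
  every direction \<open>u\<close>. This makes necessity immediate: near a local minimizer all the
  difference quotients are nonnegative.

  For sufficiency, fix a unit vector \<open>u\<close>. Either every derivative of order \<open>1, \<dots>, n - 1\<close> in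
  the direction \<open>u\<close> vanishes, and then membership in the class \<open>Fclass n x\<close> yields growth of order
  \<open>n\<close> on a truncated cone around \<open>u\<close> (lemma \<open>Fclass_growth\<close>); or one of them, being
  nonnegative, is positive, and then \<open>f\<close> grows on such a cone at a rate \<open>t\<^sup>i\<close> with \<open>i < n\<close>,
  which dominates \<open>t\<^sup>n\<close> for small \<open>t\<close> (lemma \<open>growth_if_lower_deriv_pos\<close>). The unit sphere is
  compact, so finitely many of these cones cover a neighbourhood of \<open>x\<close> and the constants can be
  chosen uniformly (lemma \<open>isolated_local_minimizer_if_growth\<close>).
\<close>

section \<open>Lower derivatives and subdifferentials with zero functionals\<close>

lemma Lzero_in_Lspace: "Lzero \<in> Lspace n"
proof (induction n)
  case 0
  show ?case by (simp add: Lzero_def)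
next
  case (Suc n)
  have "\<exists>K. \<forall>u us. length us = n \<longrightarrow>
      \<bar>0::real\<bar> \<le> K * norm (u::'a) * prod_list (map norm us)"
    by (rule exI[of _ 0]) simp
  then show ?case using Suc by (simp add: Lzero_def linear_zero)
qed

lemma lower_deriv_zeros:
  assumes "i \<ge> 1"
  shows "lower_deriv f x (replicate (i - 1) Lzero) u =
    Liminf (at_right 0 \<times>\<^sub>F nhds u) (\<lambda>(t, u'). ereal (fact i / t ^ i) * (f (x + t *\<^sub>R u') - f x))"
proof -
  have "(\<Sum>j = 1..i - 1. t ^ j / fact j * (replicate (i - 1) Lzero ! (j - 1)) (replicate j u')) = 0"
    for t :: real and u' :: 'a
    using assms by (intro sum.neutral) (auto simp: Lzero_def)
  moreover have "Suc (i - 1) = i" using assms by simp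
  ultimately show ?thesis
    by (simp add: lower_deriv_def flip: zero_ereal_def)
qed

lemma Lzero_in_lower_subdiff_iff:
  assumes "i \<ge> 1"
  shows "Lzero \<in> lower_subdiff f x (replicate (i - 1) Lzero) \<longleftrightarrow>
    (\<forall>u. 0 \<le> lower_deriv f x (replicate (i - 1) Lzero) u)"
proof -
  have "Suc (i - 1) = i" using assms by simp
  moreover have "Lzero us = 0" for us :: "'a list"
    by (simp add: Lzero_def)
  ultimately show ?thesis
    by (simp add: lower_subdiff_def Lzero_in_Lspace flip: zero_ereal_def)
qed

section \<open>Difference quotients near a local minimizer\<close>

lemma eventually_at_right_prod_nhds_iff:
  fixes u :: "'a::metric_space"
  shows "(\<forall>\<^sub>F p in at_right (0::real) \<times>\<^sub>F nhds u. P p) \<longleftrightarrow>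
    (\<exists>\<delta>>0. \<exists>\<epsilon>>0. \<forall>t u'. 0 < t \<and> t < \<delta> \<and> dist u' u < \<epsilon> \<longrightarrow> P (t, u'))"
proof
  assume "\<forall>\<^sub>F p in at_right (0::real) \<times>\<^sub>F nhds u. P p"
  then obtain Q R where QR: "eventually Q (at_right (0::real))" "eventually R (nhds u)"
      "\<And>t u'. Q t \<Longrightarrow> R u' \<Longrightarrow> P (t, u')"
    unfolding eventually_prod_filter by blast
  obtain \<delta> where "\<delta> > 0" "\<And>t. 0 < t \<Longrightarrow> t < \<delta> \<Longrightarrow> Q t"
    using QR(1) unfolding eventually_at_right_field by auto
  moreover obtain \<epsilon> where "\<epsilon> > 0" "\<And>u'. dist u' u < \<epsilon> \<Longrightarrow> R u'"
    using QR(2) unfolding eventually_nhds_metric by auto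
  ultimately show "\<exists>\<delta>>0. \<exists>\<epsilon>>0. \<forall>t u'. 0 < t \<and> t < \<delta> \<and> dist u' u < \<epsilon> \<longrightarrow> P (t, u')"
    using QR(3) by blast
next
  assume "\<exists>\<delta>>0. \<exists>\<epsilon>>0. \<forall>t u'. 0 < t \<and> t < \<delta> \<and> dist u' u < \<epsilon> \<longrightarrow> P (t, u')"
  then obtain \<delta> \<epsilon> where *: "\<delta> > 0" "\<epsilon> > 0"
      "\<And>t u'. 0 < t \<Longrightarrow> t < \<delta> \<Longrightarrow> dist u' u < \<epsilon> \<Longrightarrow> P (t, u')" by blast
  have "\<forall>\<^sub>F t in at_right 0. 0 < t \<and> t < \<delta>"
    using *(1) unfolding eventually_at_right_field by auto
  moreover have "\<forall>\<^sub>F u' in nhds u. dist u' u < \<epsilon>"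
    using *(2) unfolding eventually_nhds_metric by auto
  ultimately show "\<forall>\<^sub>F p in at_right (0::real) \<times>\<^sub>F nhds u. P p"
    unfolding eventually_prod_filter using *(3) by blast
qed

lemma Liminf_diff_quotient_nonneg_if_local_min:
  fixes f :: "'a::real_normed_vector \<Rightarrow> ereal"
  assumes fx: "\<bar>f x\<bar> \<noteq> \<infinity>" and min: "\<forall>\<^sub>F y in nhds x. f x \<le> f y"
  shows "0 \<le> Liminf (at_right 0 \<times>\<^sub>F nhds u)
    (\<lambda>(t, u'). ereal (fact i / t ^ i) * (f (x + t *\<^sub>R u') - f x))"
proof (rule Liminf_bounded)
  \<comment> \<open>As \<open>t\<close> tends to 0 and \<open>u'\<close> to \<open>u\<close>, the point \<open>x + t u'\<close> tends to \<open>x\<close>.\<close>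
  have "filterlim (\<lambda>p. x + fst p *\<^sub>R snd p) (nhds (x + 0 *\<^sub>R u)) (at_right (0::real) \<times>\<^sub>F nhds u)"
  proof (intro tendsto_intros)
    show "(fst \<longlongrightarrow> 0) (at_right (0::real) \<times>\<^sub>F nhds u)"
      by (rule filterlim_mono[OF filterlim_fst _ order.refl]) (simp add: at_within_def)
    show "(snd \<longlongrightarrow> u) (at_right (0::real) \<times>\<^sub>F nhds u)"
      by (rule filterlim_snd)
  qed
  then have "\<forall>\<^sub>F p in at_right (0::real) \<times>\<^sub>F nhds u. f x \<le> f (x + fst p *\<^sub>R snd p)"
    using min by (auto dest: eventually_compose_filterlim)
  moreover have "\<forall>\<^sub>F p in at_right (0::real) \<times>\<^sub>F nhds u. fst p > 0"
    unfolding eventually_at_right_prod_nhds_iff by (auto intro: exI[of _ 1])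
  ultimately show "\<forall>\<^sub>F p in at_right (0::real) \<times>\<^sub>F nhds u.
      0 \<le> (case p of (t, u') \<Rightarrow> ereal (fact i / t ^ i) * (f (x + t *\<^sub>R u') - f x))"
  proof eventually_elim
    case (elim p)
    have "0 \<le> f (x + fst p *\<^sub>R snd p) - f x"
      using elim(1) fx by (simp add: ereal_diff_positive)
    then show ?case using elim(2) by (auto simp: case_prod_beta)
  qed
qed

section \<open>Growth on cones of directions\<close>

text \<open>
  One number \<open>d\<close> bounds the range of \<open>t\<close> and is also the growth constant, so that a smaller
  \<open>d\<close> gives a weaker statement, which is what passing to finitely many directions will need.
\<close>

definition growth_on :: "nat \<Rightarrow> ('a::real_normed_vector \<Rightarrow> ereal) \<Rightarrow> 'a \<Rightarrow> 'a set \<Rightarrow> real \<Rightarrow> bool"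
  where "growth_on n f x U d \<longleftrightarrow>
    (\<forall>t u'. 0 \<le> t \<and> t < d \<and> u' \<in> U \<longrightarrow> f x + ereal (d * t ^ n) \<le> f (x + t *\<^sub>R u'))"

lemma growth_on_min:
  fixes f :: "'a::real_normed_vector \<Rightarrow> ereal"
  assumes "\<And>t u'. 0 \<le> t \<Longrightarrow> t < \<delta> \<Longrightarrow> u' \<in> U \<Longrightarrow> f x + ereal (\<alpha> * t ^ n) \<le> f (x + t *\<^sub>R u')"
    and "d \<le> \<delta>" "d \<le> \<alpha>"
  shows "growth_on n f x U d"
  unfolding growth_on_def
proof (intro allI impI, elim conjE)
  fix t u' assume t: "0 \<le> t" "t < d" "u' \<in> U"
  have "f x + ereal (d * t ^ n) \<le> f x + ereal (\<alpha> * t ^ n)"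
    using t assms(3) by (intro add_left_mono) (simp add: mult_right_mono)
  also have "\<dots> \<le> f (x + t *\<^sub>R u')" using t assms by simp
  finally show "f x + ereal (d * t ^ n) \<le> f (x + t *\<^sub>R u')" .
qed

lemma growth_on_antimono:
  fixes f :: "'a::real_normed_vector \<Rightarrow> ereal"
  assumes "growth_on n f x U e" "d \<le> e"
  shows "growth_on n f x U d"
  by (rule growth_on_min[where \<delta> = e and \<alpha> = e]) (use assms in \<open>auto simp: growth_on_def\<close>)

text \<open>
  Below a positive lower limit of the quotients \<open>i! t\<^sup>-\<^sup>i (f (x + t u') - f x)\<close> there is a real
  \<open>c > 0\<close> that these quotients eventually exceed. Hence \<open>f\<close> grows at least like \<open>(c / i!) t\<^sup>i\<close>,
  and \<open>t\<^sup>i \<ge> t\<^sup>n\<close> on \<open>[0, 1]\<close>.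
\<close>

lemma growth_if_lower_deriv_pos:
  fixes f :: "'a::euclidean_space \<Rightarrow> ereal"
  assumes fx: "\<bar>f x\<bar> \<noteq> \<infinity>" and i: "1 \<le> i" "i \<le> n"
    and pos: "0 < lower_deriv f x (replicate (i - 1) Lzero) u"
  shows "\<exists>\<epsilon>>0. \<exists>d>0. growth_on n f x (ball u \<epsilon>) d"
proof -
  obtain a where a: "f x = ereal a" using fx by auto
  obtain c where c: "0 < ereal c" "ereal c < lower_deriv f x (replicate (i - 1) Lzero) u"
    using ereal_dense2[OF pos] by auto
  have "\<forall>\<^sub>F p in at_right (0::real) \<times>\<^sub>F nhds u.
      ereal c < (case p of (t, u') \<Rightarrow> ereal (fact i / t ^ i) * (f (x + t *\<^sub>R u') - f x))"
    using c(2) less_LiminfD unfolding lower_deriv_zeros[OF i(1)] by blast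
  then obtain \<delta> \<epsilon> where \<delta>: "\<delta> > 0" and \<epsilon>: "\<epsilon> > 0"
    and quot: "\<And>t u'. 0 < t \<Longrightarrow> t < \<delta> \<Longrightarrow> dist u' u < \<epsilon> \<Longrightarrow>
      ereal c < ereal (fact i / t ^ i) * (f (x + t *\<^sub>R u') - f x)"
    unfolding eventually_at_right_prod_nhds_iff by auto
  define d where "d = min (min \<delta> 1) (c / fact i)"
  have "growth_on n f x (ball u \<epsilon>) d"
  proof (rule growth_on_min)
    fix t u' assume t: "0 \<le> t" "t < min \<delta> 1" "u' \<in> ball u \<epsilon>"
    show "f x + ereal (c / fact i * t ^ n) \<le> f (x + t *\<^sub>R u')"
    proof (cases "t = 0")
      case True
      then show ?thesis using i by (simp add: power_0_left flip: zero_ereal_def)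
    next
      case False
      then have q: "ereal c < ereal (fact i / t ^ i) * (f (x + t *\<^sub>R u') - f x)"
        and t0: "0 < t"
        using quot t by (auto simp: dist_commute)
      have tin: "t ^ n \<le> t ^ i" using t t0 i by (intro power_decreasing) auto
      show ?thesis
      proof (cases "f (x + t *\<^sub>R u')")
        case (real b)
        have "c / fact i * t ^ n \<le> c / fact i * t ^ i"
          using c(1) tin by (intro mult_left_mono) auto
        also have "\<dots> \<le> b - a"
          using q t0 by (simp add: real a field_simps)
        finally show ?thesis by (simp add: real a)
      next
        case PInf
        then show ?thesis by simp
      next
        case MInf
        then show ?thesis using q c(1) t0 by (simp add: a)
      qed
    qed
  qed (auto simp: d_def)
  moreover have "d > 0" using \<delta> c(1) by (simp add: d_def)
  ultimately show ?thesis using \<epsilon> by blast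
qed

lemma Fclass_growth:
  fixes f :: "'a::euclidean_space \<Rightarrow> ereal"
  assumes "f \<in> Fclass n x" "norm u = 1"
    and "\<forall>i\<in>{1..n - 2}. Lzero \<in> lower_subdiff f x (replicate (i - 1) Lzero)"
    and "\<forall>i\<in>{1..n - 1}. lower_deriv f x (replicate (i - 1) Lzero) u = 0"
  shows "\<exists>\<epsilon>>0. \<exists>d>0. growth_on n f x (ball u \<epsilon>) d"
proof -
  have "\<exists>\<epsilon>>0. \<exists>\<delta>>0. \<exists>\<alpha>>0. \<forall>(t::real) u'. 0 \<le> t \<and> t < \<delta> \<and> norm (u' - u) < \<epsilon> \<longrightarrow>
      f (x + t *\<^sub>R u') \<ge> f x + ereal (\<alpha> * t ^ n)"
    using assms(1)[unfolded Fclass_def mem_Collect_eq, THEN conjunct2, THEN conjunct2,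
        rule_format, OF assms(2) bspec[OF assms(3)] bspec[OF assms(4)]] .
  then obtain \<epsilon> \<delta> \<alpha> where *: "\<epsilon> > 0" "\<delta> > 0" "\<alpha> > 0"
    "\<And>t u'. 0 \<le> t \<Longrightarrow> t < \<delta> \<Longrightarrow> norm (u' - u) < \<epsilon> \<Longrightarrow>
      f (x + t *\<^sub>R u') \<ge> f x + ereal (\<alpha> * t ^ n)"
    by metis
  have "growth_on n f x (ball u \<epsilon>) (min \<delta> \<alpha>)"
    by (rule growth_on_min[where \<delta> = \<delta> and \<alpha> = \<alpha>])
      (use * in \<open>auto simp: dist_norm norm_minus_commute\<close>)
  then show ?thesis using * by (metis min_less_iff_conj)
qed

text \<open>
  Finitely many of the balls cover the compact unit sphere, and the least of their constants serves
  for all directions. A nearby point \<open>y \<noteq> x\<close> is then reached as \<open>x + t u'\<close> with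
  \<open>t = norm (y - x)\<close> and \<open>u'\<close> on the sphere.
\<close>

lemma isolated_local_minimizer_if_growth:
  fixes f :: "'a::euclidean_space \<Rightarrow> ereal"
  assumes "x \<in> edom f" "n \<ge> 1"
    and cone: "\<And>u. norm u = 1 \<Longrightarrow> \<exists>\<epsilon>>0. \<exists>d>0. growth_on n f x (ball u \<epsilon>) d"
  shows "isolated_local_minimizer n f x"
proof -
  obtain \<epsilon> where \<epsilon>: "\<And>u. norm u = 1 \<Longrightarrow> \<epsilon> u > 0 \<and> (\<exists>d>0. growth_on n f x (ball u (\<epsilon> u)) d)"
    using cone by metis
  have cover: "sphere 0 1 \<subseteq> (\<Union>u\<in>sphere 0 1. ball u (\<epsilon> u))"
    using \<epsilon> by force
  have "compact (sphere (0::'a) 1)" by simp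
  then obtain F where F: "F \<subseteq> sphere 0 1" "finite F" "sphere 0 1 \<subseteq> (\<Union>u\<in>F. ball u (\<epsilon> u))"
    by (rule compactE_image[OF _ _ cover]) auto
  \<comment> \<open>Choosing a common constant through a filter spares a minimum over a possibly empty set.\<close>
  have "\<forall>\<^sub>F d in at_right (0::real). \<forall>u\<in>F. growth_on n f x (ball u (\<epsilon> u)) d"
  proof (intro eventually_ball_finite F(2) ballI)
    fix u assume "u \<in> F"
    then obtain d where "d > 0" "growth_on n f x (ball u (\<epsilon> u)) d" using F(1) \<epsilon> by force
    then show "\<forall>\<^sub>F d in at_right 0. growth_on n f x (ball u (\<epsilon> u)) d"
      unfolding eventually_at_right_field using growth_on_antimono less_imp_le by metis
  qed
  then have "\<forall>\<^sub>F d in at_right (0::real). 0 < d \<and> (\<forall>u\<in>F. growth_on n f x (ball u (\<epsilon> u)) d)"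
    by (intro eventually_conj eventually_at_right_less)
  then have "\<exists>d>0. \<forall>u\<in>F. growth_on n f x (ball u (\<epsilon> u)) d"
    by (rule eventually_happens'[OF trivial_limit_at_right_real])
  then obtain d where d: "d > 0" "\<And>u. u \<in> F \<Longrightarrow> growth_on n f x (ball u (\<epsilon> u)) d"
    by auto
  have "f x + ereal (d * norm (y - x) ^ n) \<le> f y" if y: "y \<in> ball x d" for y
  proof (cases "y = x")
    case True
    then show ?thesis using \<open>n \<ge> 1\<close> by (simp add: power_0_left flip: zero_ereal_def)
  next
    case False
    define t where "t = norm (y - x)"
    define u' where "u' = (1 / t) *\<^sub>R (y - x)"
    have "t > 0" "t < d" using False y by (auto simp: t_def dist_norm norm_minus_commute)
    then have y_eq: "y = x + t *\<^sub>R u'" by (simp add: u'_def)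
    have "norm u' = 1" using \<open>t > 0\<close> by (simp add: u'_def flip: t_def)
    then have "u' \<in> sphere 0 1" by simp
    then obtain u where u: "u \<in> F" "u' \<in> ball u (\<epsilon> u)" using F(3) by blast
    then have "f x + ereal (d * t ^ n) \<le> f (x + t *\<^sub>R u')"
      using d(2)[OF u(1)] \<open>t > 0\<close> \<open>t < d\<close> by (simp add: growth_on_def)
    then show ?thesis unfolding y_eq[symmetric] by (simp add: t_def)
  qed
  then show ?thesis
    unfolding isolated_local_minimizer_def using assms(1) d(1)
    by (intro conjI exI[of _ "ball x d"]) auto
qed

section \<open>Characterization of isolated local minimizers\<close>

theorem theorem7p3:
  fixes f :: "'a::euclidean_space \<Rightarrow> ereal" and x :: 'a and n :: nat
  assumes "n \<ge> 2" and "f \<in> Fclass n x"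
  shows "isolated_local_minimizer n f x \<longleftrightarrow>
    Lzero \<in> lower_subdiff f x [] \<and>
    (\<forall>i\<in>{2..n - 1}. Lzero \<in> lower_subdiff f x (replicate (i - 1) Lzero))"
proof -
  have dom: "x \<in> edom f" and fx: "\<bar>f x\<bar> \<noteq> \<infinity>"
    using assms(2) by (auto simp: Fclass_def edom_def proper_ext_def)
  have indices: "{1..n - 1} = insert 1 {2..n - 1}" using assms(1) by auto
  have "Lzero \<in> lower_subdiff f x [] \<and>
      (\<forall>i\<in>{2..n - 1}. Lzero \<in> lower_subdiff f x (replicate (i - 1) Lzero)) \<longleftrightarrow>
      (\<forall>i\<in>{1..n - 1}. Lzero \<in> lower_subdiff f x (replicate (i - 1) Lzero))"
    unfolding indices by simp
  also have "\<dots> \<longleftrightarrow> isolated_local_minimizer n f x"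
  proof
    assume L: "\<forall>i\<in>{1..n - 1}. Lzero \<in> lower_subdiff f x (replicate (i - 1) Lzero)"
    show "isolated_local_minimizer n f x"
    proof (rule isolated_local_minimizer_if_growth[OF dom])
      fix u :: 'a assume u: "norm u = 1"
      show "\<exists>\<epsilon>>0. \<exists>d>0. growth_on n f x (ball u \<epsilon>) d"
      proof (cases "\<forall>i\<in>{1..n - 1}. lower_deriv f x (replicate (i - 1) Lzero) u = 0")
        case True
        then show ?thesis using L by (intro Fclass_growth assms u) auto
      next
        case False
        then obtain i where i: "1 \<le> i" "i \<le> n - 1"
          and "lower_deriv f x (replicate (i - 1) Lzero) u \<noteq> 0" by auto
        moreover have "0 \<le> lower_deriv f x (replicate (i - 1) Lzero) u"
          using L i Lzero_in_lower_subdiff_iff[OF i(1)] by (meson atLeastAtMost_iff)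
        ultimately show ?thesis
          by (intro growth_if_lower_deriv_pos[where i = i] fx) auto
      qed
    qed (use assms(1) in simp)
  next
    assume "isolated_local_minimizer n f x"
    then obtain N C where N: "x \<in> interior N" and "C > 0"
      and growth: "\<And>y. y \<in> N \<Longrightarrow> f x + ereal (C * norm (y - x) ^ n) \<le> f y"
      unfolding isolated_local_minimizer_def by blast
    have "f x \<le> f y" if "y \<in> N" for y
    proof -
      have "f x + 0 \<le> f x + ereal (C * norm (y - x) ^ n)"
        using \<open>C > 0\<close> by (intro add_left_mono) simp
      then show ?thesis using growth[OF that] by simp
    qed
    then have "\<forall>\<^sub>F y in nhds x. f x \<le> f y"
      using N interior_subset open_interior unfolding eventually_nhds by blast
    note nonneg = Liminf_diff_quotient_nonneg_if_local_min[of f x, OF fx this]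
    show "\<forall>i\<in>{1..n - 1}. Lzero \<in> lower_subdiff f x (replicate (i - 1) Lzero)"
    proof
      fix i assume "i \<in> {1..n - 1}"
      then have i: "1 \<le> i" by simp
      show "Lzero \<in> lower_subdiff f x (replicate (i - 1) Lzero)"
        unfolding Lzero_in_lower_subdiff_iff[OF i] lower_deriv_zeros[OF i]
        by (intro allI nonneg)
    qed
  qed
  finally show ?thesis by (rule sym)
qed

end
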